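(* Let $X\subset\mathbb{R}^n$ be a non-empty convex set and $\mathcal{A}\subset\mathbb{R}^n$ a non-empty finite set. Let $\nu^{(1)}$ and $\nu^{(2)}$ be $X$-circuits of $\mathcal{A}$ with the same signed support and such that $\mathcal{A}\nu^{(1)}=\mathcal{A}\nu^{(2)}$. Then $\nu^{(1)}$ and $\nu^{(2)}$ are proportional, and in case $\mathcal{A}\nu^{(1)}=\mathcal{A}\nu^{(2)}\neq\mathbf{0}$, the equality $\nu^{(1)}=\nu^{(2)}$ holds.
   Context: $\mathbb{R}^{\mathcal{A}}$ is the set of real vectors indexed by $\mathcal{A}$. For $\beta\in\mathcal{A}$, $N_\beta=\{\nu\in\mathbb{R}^{\mathcal{A}} : \nu_\alpha\ge 0 \text{ for all }\alpha\in\mathcal{A}\setminus\{\beta\},\ \sum_{\alpha\in\mathcal{A}}\nu_\alpha=0\}$. For $\nu\in\mathbb{R}^{\mathcal{A}}$ write $\mathcal{A}\nu=\sum_{\alpha\in\mathcal{A}}\alpha\,\nu_\alpha\in\mathbb{R}^n$. $\sigma_X(y)=\sup\{y^Tx : x\in X\}$ is the support function. A non-zero vector $\nu^*\in N_\beta$ (for some $\beta\in\mathcal{A}$) is an $X$-circuit (sublinear circuit of $\mathcal{A}$ with respect to $X$) if (i) $\sigma_X(-\mathcal{A}\nu^* )<\infty$, and (ii) whenever the map $\nu\mapsto\sigma_X(-\mathcal{A}\nu)$ is linear on a two-dimensional convex cone contained in $N_\beta$ (i.e. is finite there and coincides there with a linear function), $\nu^*$ is not in the relative interior of that cone. Two vectors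 have the same signed support if their sets of indices with positive entry coincide and their sets of indices with negative entry coincide. *)

theory Defs
  imports "HOL-Analysis.Analysis"
begin

text \<open>
  A non-empty finite set of exponents in \<open>\<real>\<^sup>n\<close> is given as an enumeration \<open>\<A> :: 'a \<Rightarrow> real^'n\<close> by a
  finite index type, to be assumed injective; the set itself is \<open>range \<A>\<close>. The space of real vectors
  indexed by the set is then \<open>real^'a\<close>, and an index \<open>\<beta> :: 'a\<close> stands for the exponent \<open>\<A> \<beta>\<close>.
\<close>

definition exps_mult :: "('a::finite \<Rightarrow> real^'n) \<Rightarrow> real^'a \<Rightarrow> real^'n"
  where "exps_mult \<A> \<nu> = (\<Sum>\<alpha>\<in>UNIV. (\<nu> $ \<alpha>) *\<^sub>R \<A> \<alpha>)"

definition N_cone :: "'a::finite \<Rightarrow> (real^'a) set"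
  where "N_cone \<beta> = {\<nu>. (\<forall>\<alpha>. \<alpha> \<noteq> \<beta> \<longrightarrow> \<nu> $ \<alpha> \<ge> 0) \<and> (\<Sum>\<alpha>\<in>UNIV. \<nu> $ \<alpha>) = 0}"

definition support_function :: "(real^'n) set \<Rightarrow> real^'n \<Rightarrow> ereal"
  where "support_function X y = (SUP x\<in>X. ereal (y \<bullet> x))"

definition linear_on_cone :: "('v::real_vector \<Rightarrow> ereal) \<Rightarrow> 'v set \<Rightarrow> bool"
  where "linear_on_cone g C \<longleftrightarrow> (\<exists>f::'v \<Rightarrow> real. linear f \<and> (\<forall>\<nu>\<in>C. g \<nu> = ereal (f \<nu>)))"

text \<open>
  A \<open>convex_cone\<close> contains the origin, so its dimension as a convex set is the dimension \<open>dim\<close> of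
  its linear span.
\<close>

definition X_circuit :: "(real^'n) set \<Rightarrow> ('a::finite \<Rightarrow> real^'n) \<Rightarrow> real^'a \<Rightarrow> bool"
  where "X_circuit X \<A> \<nu>' \<longleftrightarrow> \<nu>' \<noteq> 0 \<and>
    (\<exists>\<beta>. \<nu>' \<in> N_cone \<beta> \<and>
      support_function X (- exps_mult \<A> \<nu>') < \<infinity> \<and>
      (\<forall>C. convex_cone C \<and> dim C = 2 \<and> C \<subseteq> N_cone \<beta> \<and>
            linear_on_cone (\<lambda>\<nu>. support_function X (- exps_mult \<A> \<nu>)) C
          \<longrightarrow> \<nu>' \<notin> rel_interior C))"

definition same_signed_support :: "real^'a \<Rightarrow> real^'a \<Rightarrow> bool"
  where "same_signed_support \<nu> \<nu>' \<longleftrightarrow>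
    {\<alpha>. \<nu> $ \<alpha> > 0} = {\<alpha>. \<nu>' $ \<alpha> > 0} \<and> {\<alpha>. \<nu> $ \<alpha> < 0} = {\<alpha>. \<nu>' $ \<alpha> < 0}"

end

theory Submission
  imports Defs
begin

text \<open>
  If \<open>\<nu>1\<close> and \<open>\<nu>2\<close> are linearly independent, then for large \<open>K\<close> the vector \<open>K \<nu>1 - \<nu>2\<close> still lies in
  \<open>N\<^sub>\<beta>\<close>, because the signed supports agree. The cone spanned by \<open>\<nu>2\<close> and \<open>K \<nu>1 - \<nu>2\<close> is
  two-dimensional, contains \<open>\<nu>1\<close> in its relative interior, and is mapped by \<open>\<nu> \<mapsto> - \<A> \<nu>\<close> into the ray
  through \<open>- \<A> \<nu>1\<close>. The support function is positively homogeneous, hence linear on that ray,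
  so \<open>\<nu>1\<close> is not a circuit.
\<close>

lemma linear_exps_mult: "linear (exps_mult \<A>)"
  by (rule linearI)
     (simp_all add: exps_mult_def scaleR_add_left sum.distrib scaleR_sum_right)

text \<open>Non-emptiness matters at \<open>t = 0\<close>: for empty \<open>X\<close> the left side
  is \<open>-\<infinity>\<close>, whereas the product on the right is 0.\<close>

lemma support_function_scaleR:
  assumes "X \<noteq> {}" and "0 \<le> t"
  shows "support_function X (t *\<^sub>R y) = ereal t * support_function X y"
  using Sup_ereal_mult_left'[OF assms, of "\<lambda>x. ereal (y \<bullet> x)"]
  by (simp add: support_function_def)

lemma support_function_neq_MInf:
  assumes "X \<noteq> {}"
  shows "support_function X y \<noteq> -\<infinity>"
proof -
  obtain x where "x \<in> X" using assms by blast
  then have "ereal (y \<bullet> x) \<le> support_function X y"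
    unfolding support_function_def by (rule SUP_upper)
  then show ?thesis by auto
qed

lemma convex_cone_N_cone: "convex_cone (N_cone \<beta>)"
  unfolding convex_cone_iff N_cone_def
  by (auto simp: sum.distrib simp flip: sum_distrib_left)

text \<open>\<open>C\<close> is the image of the closed quadrant under an injective linear map,
  which carries over convexity, dimension and relative interior.\<close>

lemma simplicial_cone_2:
  fixes u v :: "'v::euclidean_space"
  assumes indep: "\<And>a b. a *\<^sub>R u + b *\<^sub>R v = 0 \<Longrightarrow> a = 0 \<and> b = 0"
  defines "C \<equiv> (\<lambda>(a, b). a *\<^sub>R u + b *\<^sub>R v) ` ({0..} \<times> {0..})"
  shows "convex_cone C" and "dim C = 2"
    and "\<And>a b. 0 < a \<Longrightarrow> 0 < b \<Longrightarrow> a *\<^sub>R u + b *\<^sub>R v \<in> rel_interior C"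
proof -
  let ?T = "\<lambda>(a::real, b::real). a *\<^sub>R u + b *\<^sub>R v"
  let ?Q = "{0::real..} \<times> {0::real..}"
  have lin: "linear ?T"
    by (rule linearI) (auto simp: algebra_simps)
  have inj: "inj ?T"
    unfolding linear_injective_0[OF lin] using indep by (auto simp: zero_prod_def)
  have cone: "convex_cone ?Q"
    by (auto simp: convex_cone_iff zero_prod_def)
  then show "convex_cone C"
    unfolding C_def using convex_cone_linear_image lin by blast
  \<comment> \<open>An interior point shows that the quadrant spans the plane.\<close>
  have "(1, 1) \<in> interior ?Q"
    by (simp add: interior_Times)
  then have "\<not> dim ?Q < DIM(real \<times> real)"
    using empty_interior_lowdim by blast
  then have "dim ?Q = 2"
    using dim_subset_UNIV[of ?Q] by simp
  then show "dim C = 2"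
    unfolding C_def using dim_image_eq[OF lin inj_on_subset[OF inj]] by simp
  fix a b :: real
  assume "0 < a" "0 < b"
  then have "(a, b) \<in> rel_interior ?Q"
    by (simp add: rel_interior_Times)
  then have "?T (a, b) \<in> ?T ` rel_interior ?Q"
    by (rule imageI)
  then show "a *\<^sub>R u + b *\<^sub>R v \<in> rel_interior C"
    unfolding C_def
    using rel_interior_convex_linear_image[OF lin, of ?Q] cone
    by (simp add: convex_cone_def)
qed

lemma N_cone_scaleR_diff:
  assumes \<nu>: "\<nu> \<in> N_cone \<beta>" and \<mu>: "\<mu> \<in> N_cone \<beta>"
    and supp: "\<And>\<alpha>. \<alpha> \<noteq> \<beta> \<Longrightarrow> \<mu> $ \<alpha> > 0 \<Longrightarrow> \<nu> $ \<alpha> > 0"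
  obtains K where "K > 1" and "K *\<^sub>R \<nu> - \<mu> \<in> N_cone \<beta>"
proof -
  \<comment> \<open>All summands are non-negative, so the sum dominates each quotient; unlike a
    maximum it is also defined when \<open>\<beta>\<close> is the only index. Adding 2 secures
    \<open>K > 1\<close>.\<close>
  define K where "K = 2 + (\<Sum>\<alpha>\<in>UNIV - {\<beta>}. \<mu> $ \<alpha> / \<nu> $ \<alpha>)"
  have quot: "0 \<le> \<mu> $ \<alpha> / \<nu> $ \<alpha>" if "\<alpha> \<noteq> \<beta>" for \<alpha>
    using \<nu> \<mu> that by (simp add: N_cone_def)
  then have "0 \<le> (\<Sum>\<alpha>\<in>UNIV - {\<beta>}. \<mu> $ \<alpha> / \<nu> $ \<alpha>)"
    by (intro sum_nonneg) simp
  then have "K > 1"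
    by (simp add: K_def)
  have "\<mu> $ \<alpha> \<le> K * \<nu> $ \<alpha>" if "\<alpha> \<noteq> \<beta>" for \<alpha>
  proof (cases "\<mu> $ \<alpha> > 0")
    case True
    have "\<mu> $ \<alpha> / \<nu> $ \<alpha> \<le> (\<Sum>\<alpha>\<in>UNIV - {\<beta>}. \<mu> $ \<alpha> / \<nu> $ \<alpha>)"
      using that quot by (intro member_le_sum) auto
    then have "\<mu> $ \<alpha> / \<nu> $ \<alpha> \<le> K"
      by (simp add: K_def)
    then show ?thesis
      using supp[OF that True] by (simp add: pos_divide_le_eq)
  next
    case False
    moreover have "0 \<le> K * \<nu> $ \<alpha>"
      using \<nu> that \<open>K > 1\<close> by (simp add: N_cone_def)
    ultimately show ?thesis by linarith
  qed
  then have "K *\<^sub>R \<nu> - \<mu> \<in> N_cone \<beta>"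
    using \<nu> \<mu> by (simp add: N_cone_def sum_subtractf flip: sum_distrib_left)
  with \<open>K > 1\<close> show thesis by (rule that)
qed

text \<open>On the ray through \<open>- w\<close> the support function is \<open>t\<close> times its
  finite value at \<open>- w\<close>. The factor \<open>t\<close> is recovered linearly from
  \<open>A \<nu>\<close> by projecting onto \<open>w\<close>.\<close>

lemma linear_on_cone_support_function:
  assumes "X \<noteq> {}" and "support_function X (- w) < \<infinity>" and "linear A"
    and ray: "\<And>\<nu>. \<nu> \<in> C \<Longrightarrow> \<exists>t\<ge>0. A \<nu> = t *\<^sub>R w"
  shows "linear_on_cone (\<lambda>\<nu>. support_function X (- A \<nu>)) C"
proof -
  obtain s where s: "support_function X (- w) = ereal s"
    using assms(2) support_function_neq_MInf[OF assms(1), of "- w"]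
    by (cases "support_function X (- w)") auto
  have s0: "s = 0" if "w = 0"
    using s support_function_scaleR[OF assms(1), of 0 0] that by simp
  \<comment> \<open>If \<open>w = 0\<close>, division by zero makes this the zero functional, which is correct since then \<open>s = 0\<close>.\<close>
  define f where "f \<nu> = (A \<nu> \<bullet> w) * (s / (w \<bullet> w))" for \<nu>
  have "linear f"
    unfolding f_def
    by (rule linearI)
       (simp_all add: linear_add[OF assms(3)] linear_scale[OF assms(3)] algebra_simps add_divide_distrib)
  moreover have "support_function X (- A \<nu>) = ereal (f \<nu>)" if mem: "\<nu> \<in> C" for \<nu>
  proof -
    obtain t where t: "t \<ge> 0" "A \<nu> = t *\<^sub>R w" using ray[OF mem] by blast
    then have "support_function X (- A \<nu>) = ereal (t * s)"
      using support_function_scaleR[OF assms(1) t(1), of "- w"] s by simp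
    also have "t * s = f \<nu>"
      using s0 t by (cases "w = 0") (simp_all add: f_def)
    finally show ?thesis .
  qed
  ultimately show ?thesis
    unfolding linear_on_cone_def by blast
qed

theorem lemma3p3:
  fixes X :: "(real^'n) set" and \<A> :: "'a::finite \<Rightarrow> real^'n" and \<nu>1 \<nu>2 :: "real^'a"
  assumes "X \<noteq> {}" and "convex X"
    and "inj \<A>"
    and "X_circuit X \<A> \<nu>1" and "X_circuit X \<A> \<nu>2"
    and "same_signed_support \<nu>1 \<nu>2"
    and "exps_mult \<A> \<nu>1 = exps_mult \<A> \<nu>2"
  shows "(\<exists>c::real. c \<noteq> 0 \<and> \<nu>1 = c *\<^sub>R \<nu>2) \<and> (exps_mult \<A> \<nu>1 \<noteq> 0 \<longrightarrow> \<nu>1 = \<nu>2)"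
proof -
  let ?w = "exps_mult \<A> \<nu>1"
  note lin = linear_exps_mult[of \<A>]
  have nz: "\<nu>1 \<noteq> 0" "\<nu>2 \<noteq> 0"
    using assms(4,5) by (auto simp: X_circuit_def)
  obtain \<beta> where \<beta>: "\<nu>1 \<in> N_cone \<beta>" "support_function X (- ?w) < \<infinity>"
    and circuit: "\<And>C. convex_cone C \<Longrightarrow> dim C = 2 \<Longrightarrow> C \<subseteq> N_cone \<beta> \<Longrightarrow>
      linear_on_cone (\<lambda>\<nu>. support_function X (- exps_mult \<A> \<nu>)) C \<Longrightarrow> \<nu>1 \<notin> rel_interior C"
    using assms(4) unfolding X_circuit_def by blast
  have pos: "\<nu>1 $ \<alpha> > 0 \<longleftrightarrow> \<nu>2 $ \<alpha> > 0" and neg: "\<nu>1 $ \<alpha> < 0 \<longleftrightarrow> \<nu>2 $ \<alpha> < 0" for \<alpha>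
    using assms(6) by (auto simp: same_signed_support_def)
  \<comment> \<open>The circuit \<open>\<nu>2\<close> may come with another index; equal negative
    supports place it in the cone of the same \<open>\<beta>\<close>.\<close>
  have "(\<Sum>\<alpha>\<in>UNIV. \<nu>2 $ \<alpha>) = 0"
    using assms(5) by (auto simp: X_circuit_def N_cone_def)
  then have \<nu>2: "\<nu>2 \<in> N_cone \<beta>"
    using \<beta>(1) neg by (auto simp: N_cone_def not_less[symmetric])
  obtain K where K: "K > 1" "K *\<^sub>R \<nu>1 - \<nu>2 \<in> N_cone \<beta>"
    using N_cone_scaleR_diff[OF \<beta>(1) \<nu>2] pos by blast
  define v where "v = K *\<^sub>R \<nu>1 - \<nu>2"
  have proportional: "\<exists>c::real. \<nu>1 = c *\<^sub>R \<nu>2"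
  proof (rule ccontr)
    assume no: "\<nexists>c::real. \<nu>1 = c *\<^sub>R \<nu>2"
    have indep: "a = 0 \<and> b = 0" if "a *\<^sub>R \<nu>2 + b *\<^sub>R v = 0" for a b
    proof -
      have eq: "(b * K) *\<^sub>R \<nu>1 = (b - a) *\<^sub>R \<nu>2"
        using that by (simp add: v_def algebra_simps)
      \<comment> \<open>Otherwise \<open>eq\<close> could be solved for \<open>\<nu>1\<close> as a
        multiple of \<open>\<nu>2\<close>.\<close>
      have "b = 0"
      proof (rule ccontr)
        assume "b \<noteq> 0"
        then have "\<nu>1 = inverse (b * K) *\<^sub>R ((b * K) *\<^sub>R \<nu>1)"
          using K(1) by (simp del: inverse_mult_distrib)
        also have "\<dots> = (inverse (b * K) * (b - a)) *\<^sub>R \<nu>2"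
          unfolding eq by simp
        finally show False using no by blast
      qed
      then show ?thesis using that nz by simp
    qed
    define C where "C = (\<lambda>(a, b). a *\<^sub>R \<nu>2 + b *\<^sub>R v) ` ({0::real..} \<times> {0::real..})"
    note C = simplicial_cone_2[of \<nu>2 v, OF indep, folded C_def]
    have "C \<subseteq> N_cone \<beta>"
      using \<nu>2 K(2) convex_cone_N_cone[of \<beta>]
      by (auto simp: C_def v_def convex_cone_iff)
    moreover have "linear_on_cone (\<lambda>\<nu>. support_function X (- exps_mult \<A> \<nu>)) C"
    proof (rule linear_on_cone_support_function[OF assms(1) \<beta>(2) lin])
      fix \<nu> assume "\<nu> \<in> C"
      then obtain a b where ab: "0 \<le> a" "0 \<le> b" "\<nu> = a *\<^sub>R \<nu>2 + b *\<^sub>R v"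
        by (auto simp: C_def)
      \<comment> \<open>Since \<open>\<nu>1\<close> and \<open>\<nu>2\<close> have the same image,
        \<open>v\<close> is mapped to \<open>K - 1\<close> times it; \<open>K > 1\<close> keeps the
        images on one ray instead of a whole line.\<close>
      have "exps_mult \<A> \<nu> = a *\<^sub>R ?w + b *\<^sub>R (K *\<^sub>R ?w - ?w)"
        unfolding ab(3) v_def linear_add[OF lin] linear_diff[OF lin] linear_scale[OF lin] assms(7) ..
      then have "exps_mult \<A> \<nu> = (a + b * (K - 1)) *\<^sub>R ?w"
        by (simp add: algebra_simps)
      moreover have "0 \<le> a + b * (K - 1)"
        using ab K(1) by simp
      ultimately show "\<exists>t\<ge>0. exps_mult \<A> \<nu> = t *\<^sub>R ?w" by blast
    qed
    ultimately have "\<nu>1 \<notin> rel_interior C"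
      using C(1,2) by (intro circuit)
    \<comment> \<open>Solving the definition of \<open>v\<close> for \<open>\<nu>1\<close> gives two
      positive coefficients, hence a relative interior point.\<close>
    moreover have "\<nu>1 = inverse K *\<^sub>R \<nu>2 + inverse K *\<^sub>R v"
      using K(1) by (simp add: v_def flip: scaleR_add_right)
    ultimately show False
      using C(3)[of "inverse K" "inverse K"] K(1) by simp
  qed
  then obtain c where c: "\<nu>1 = c *\<^sub>R \<nu>2" by blast
  have "\<nu>1 = \<nu>2" if "?w \<noteq> 0"
  proof -
    \<comment> \<open>Applying the linear map to \<open>\<nu>1 = c *\<^sub>R \<nu>2\<close> compares
      the two equal images.\<close>
    have "?w = c *\<^sub>R ?w"
      using c assms(7) linear_scale[OF lin, of c \<nu>2] by simp
    then have "c = 1" using that by (metis scaleR_cancel_right scaleR_one)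
    then show ?thesis using c by simp
  qed
  moreover have "c \<noteq> 0" using c nz by auto
  ultimately show ?thesis using c by blast
qed

end
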